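(* Let $A = \{\theta \in \Theta : \theta < \theta_0\}$ be a left-sided assertion, with $\theta_0$ fixed. Suppose that, for each $x$, the right endpoint $\sup \Theta_x(u)$ is a non-decreasing (resp. non-increasing) function of $u$. Then, for the given $A$, the optimal predictive random set is $\mathcal{S}^\star = [0,U]$ (resp. $\mathcal{S}^\star = [U,1]$), where $U \sim \mathrm{Unif}(0,1)$.
   Context: Setting. $\mathbb{X}$ is the sample space and $\Theta$ the parameter space; both are one-dimensional (scalar $X$ and $\theta$, $\Theta\subseteq\mathbb{R}$). The auxiliary variable space is $\mathbb{U}=[0,1]$ with $\mathsf{P}_U = \mathrm{Unif}(0,1)$. An association is a map $a$ taking $(u,\theta)$ to $a(u,\theta)\in\mathbb{X}$ such that, for each $\theta$, the sampling distribution $\mathsf{P}_{X|\theta}$ of $X$ is the distribution of $a(U,\theta)$ when $U \sim \mathsf{P}_U$. Put $\Theta_x(u) = \{\theta\in\Theta : x = a(u,\theta)\}$. Standing assumption: $\Theta_x(u) \neq \varnothing$ for all $x\in\mathbb{X}$ and $u\in\mathbb{U}$. A predictive random set $\mathcal{S}$ is a random subset of $\mathbb{U}$ with distribution $\mathsf{P}_{\mathcal{S}}$. It is valid if $Q_{\mathcal{S}}(u) = \mathsf{P}_{\mathcal{S}}\{\mathcal{S}\not\ni u\}$ satisfies $\mathsf{P}_U\{Q_{\mathcal{S}}(U)\ge 1-\alpha\}\le\alpha$ for each $\alpha\in(0,1)$. It is nested if it is supported on a collection of $\mathsf{P}_U$-measurable sets that is totally ordered by inclusion; the nested predictive random sets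 under consideration are valid. With $\Theta_x(\mathcal{S}) = \bigcup_{u\in\mathcal{S}}\Theta_x(u)$, the belief function is $\mathsf{bel}_x(A;\mathcal{S}) = \mathsf{P}_{\mathcal{S}}\{\Theta_x(\mathcal{S})\subseteq A\}$. Let $\mathcal{S}_0=\{U\}$, $U\sim\mathsf{P}_U$, so $\mathsf{bel}_x(A;\mathcal{S}_0) = \mathsf{P}_U\{\Theta_x(U)\subseteq A\}$ (the fiducial probability). The relative efficiency is $$R_A(x;\mathcal{S}) = \mathsf{bel}_x(A;\mathcal{S})/\mathsf{bel}_x(A;\mathcal{S}_0), \quad x\in\mathbb{X},$$ considered where the denominator is non-zero. Optimality. For a left-sided assertion $A$ and two nested predictive random sets $\mathcal{S},\mathcal{S}'$, the inferential model based on $\mathcal{S}$ is more efficient than that based on $\mathcal{S}'$ if, as functions of $X\sim\mathsf{P}_{X|\theta}$ for any $\theta\in A$, $R_A(X;\mathcal{S})$ is stochastically larger (in the weak sense) than $R_A(X;\mathcal{S}')$. $\mathcal{S}^\star$ is optimal if $R_A(X;\mathcal{S}^\star)$ is stochastically largest, in this sense, among all nested predictive random sets.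
   Formalization: Added assumption: among those u with sup Θ_x(u) = θ₀ exactly, whether θ₀ belongs to Θ_x(u) is also monotone in u (once θ₀ belongs it stays for larger u; resp. for smaller u); without it the claim fails. *)

theory Defs
  imports "HOL-Probability.Probability"
begin

text \<open>The auxiliary space \<open>[0,1]\<close> with \<open>P\<^sub>U = Unif(0,1)\<close>; the space of \<open>PU\<close> is \<open>{0..1}\<close>.\<close>

definition PU :: "real measure" where
  "PU = restrict_space lborel {0..1}"

definition association ::
    "real set \<Rightarrow> real set \<Rightarrow> (real \<Rightarrow> real measure) \<Rightarrow> (real \<Rightarrow> real \<Rightarrow> real) \<Rightarrow> bool" where
  "association \<X> \<Theta> P a \<longleftrightarrow>
     (\<forall>\<theta>\<in>\<Theta>. (\<lambda>u. a u \<theta>) \<in> PU \<rightarrow>\<^sub>M restrict_space borel \<X> \<and>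
            P \<theta> = distr PU (restrict_space borel \<X>) (\<lambda>u. a u \<theta>))"

definition Theta_pt :: "real set \<Rightarrow> (real \<Rightarrow> real \<Rightarrow> real) \<Rightarrow> real \<Rightarrow> real \<Rightarrow> real set" where
  "Theta_pt \<Theta> a x u = {\<theta>\<in>\<Theta>. x = a u \<theta>}"

definition Theta_set :: "real set \<Rightarrow> (real \<Rightarrow> real \<Rightarrow> real) \<Rightarrow> real \<Rightarrow> real set \<Rightarrow> real set" where
  "Theta_set \<Theta> a x S = (\<Union>u\<in>S. Theta_pt \<Theta> a x u)"

text \<open>The endpoint is \<open>\<infinity>\<close> when the set is unbounded above.\<close>

definition right_endpoint :: "real set \<Rightarrow> (real \<Rightarrow> real \<Rightarrow> real) \<Rightarrow> real \<Rightarrow> real \<Rightarrow> ereal" where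
  "right_endpoint \<Theta> a x u = (SUP \<theta>\<in>Theta_pt \<Theta> a x u. ereal \<theta>)"

text \<open>
  A random subset of \<open>[0,1]\<close> is represented by its law on the measurable space of all subsets of
  \<open>[0,1]\<close> whose \<open>\<sigma>\<close>-algebra is generated by the events \<open>{S. S \<subseteq> K} = Pow K\<close> for \<open>K\<close> Borel.
  The events \<open>{S. u \<notin> S}\<close> are the case \<open>K = {0..1} - {u}\<close>.
\<close>

definition subset_space :: "real set measure" where
  "subset_space = sigma (Pow {0..1}) (Pow ` sets PU)"

definition random_subset :: "real set measure \<Rightarrow> bool" where
  "random_subset S \<longleftrightarrow> prob_space S \<and> sets S = sets subset_space"

definition noncoverage :: "real set measure \<Rightarrow> real \<Rightarrow> real" where
  "noncoverage S u = measure S {s \<in> space S. u \<notin> s}"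

definition valid :: "real set measure \<Rightarrow> bool" where
  "valid S \<longleftrightarrow> noncoverage S \<in> borel_measurable PU \<and>
     (\<forall>\<alpha>\<in>{0<..<1}. measure PU {u \<in> space PU. noncoverage S u \<ge> 1 - \<alpha>} \<le> \<alpha>)"

text \<open>
  A support \<open>\<S>\<close> need not itself be an event of \<open>subset_space\<close> (the chain of all \<open>[0,u]\<close> is not), so
  "supported on \<open>\<S>\<close>" says that every event containing \<open>\<S>\<close> has probability one; for an event
  \<open>\<S>\<close> this is probability one of \<open>\<S>\<close>.
\<close>

definition nested :: "real set measure \<Rightarrow> bool" where
  "nested S \<longleftrightarrow> (\<exists>\<S> \<subseteq> space S. \<S> \<subseteq> sets PU \<and> (\<forall>s\<in>\<S>. \<forall>t\<in>\<S>. s \<subseteq> t \<or> t \<subseteq> s) \<and>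
     outer_measure_of S \<S> = 1)"

definition nested_prs :: "real set measure \<Rightarrow> bool" where
  "nested_prs S \<longleftrightarrow> random_subset S \<and> valid S \<and> nested S"

text \<open>The law of the random set \<open>f U\<close> with \<open>U \<sim> Unif(0,1)\<close>.\<close>

definition set_law :: "(real \<Rightarrow> real set) \<Rightarrow> real set measure" where
  "set_law f = distr PU subset_space f"

definition bel ::
    "real set \<Rightarrow> (real \<Rightarrow> real \<Rightarrow> real) \<Rightarrow> real set \<Rightarrow> real set measure \<Rightarrow> real \<Rightarrow> real" where
  "bel \<Theta> a A S x = measure S {s \<in> space S. Theta_set \<Theta> a x s \<subseteq> A}"

definition fid :: "real set \<Rightarrow> (real \<Rightarrow> real \<Rightarrow> real) \<Rightarrow> real set \<Rightarrow> real \<Rightarrow> real" where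
  "fid \<Theta> a A x = bel \<Theta> a A (set_law (\<lambda>u. {u})) x"

definition rel_eff ::
    "real set \<Rightarrow> (real \<Rightarrow> real \<Rightarrow> real) \<Rightarrow> real set \<Rightarrow> real set measure \<Rightarrow> real \<Rightarrow> real" where
  "rel_eff \<Theta> a A S x = bel \<Theta> a A S x / fid \<Theta> a A x"

text \<open>
  \<open>f\<close> is (weakly) stochastically larger than \<open>g\<close> under \<open>M\<close>, both considered on \<open>D\<close> only.  On events
  the outer measure is the probability, so this is the usual order whenever \<open>D\<close> is an event and \<open>f\<close>,
  \<open>g\<close> are random variables; the outer measure makes it meaningful with no measurability in \<open>x\<close>.
\<close>

definition stoch_larger_on :: "real measure \<Rightarrow> real set \<Rightarrow> (real \<Rightarrow> real) \<Rightarrow> (real \<Rightarrow> real) \<Rightarrow> bool" where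
  "stoch_larger_on M D f g \<longleftrightarrow>
     (\<forall>r. outer_measure_of M {x\<in>D. g x > r} \<le> outer_measure_of M {x\<in>D. f x > r})"

definition more_efficient ::
    "real set \<Rightarrow> real set \<Rightarrow> (real \<Rightarrow> real measure) \<Rightarrow> (real \<Rightarrow> real \<Rightarrow> real) \<Rightarrow> real set \<Rightarrow>
     real set measure \<Rightarrow> real set measure \<Rightarrow> bool" where
  "more_efficient \<X> \<Theta> P a A S S' \<longleftrightarrow>
     (\<forall>\<theta>\<in>A. stoch_larger_on (P \<theta>) {x\<in>\<X>. fid \<Theta> a A x \<noteq> 0} (rel_eff \<Theta> a A S) (rel_eff \<Theta> a A S'))"

definition optimal ::
    "real set \<Rightarrow> real set \<Rightarrow> (real \<Rightarrow> real measure) \<Rightarrow> (real \<Rightarrow> real \<Rightarrow> real) \<Rightarrow> real set \<Rightarrow>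
     real set measure \<Rightarrow> bool" where
  "optimal \<X> \<Theta> P a A S \<longleftrightarrow>
     nested_prs S \<and> (\<forall>S'. nested_prs S' \<longrightarrow> more_efficient \<X> \<Theta> P a A S S')"

text \<open>
  For a set whose right endpoint is exactly \<open>c\<close>, the supremum alone does not say whether the set is
  contained in \<open>{\<theta>. \<theta> < c}\<close>: that depends on whether \<open>c\<close> belongs to it.  The following conditions
  extend monotonicity of the endpoint to this tie, an open endpoint at \<open>c\<close> counting as lying to the
  left of a closed one (\<open>bool\<close> is ordered by implication).  They hold automatically if every
  \<open>Theta_pt \<Theta> a x u\<close> attains its supremum, if none does, if \<open>c \<notin> \<Theta>\<close>, or if the endpoint is
  strictly monotone in \<open>u\<close>; without them \<open>[0,U]\<close> (resp. \<open>[U,1]\<close>) can fail to be optimal.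
\<close>

definition tie_nondecreasing ::
    "real set \<Rightarrow> (real \<Rightarrow> real \<Rightarrow> real) \<Rightarrow> real \<Rightarrow> real \<Rightarrow> bool" where
  "tie_nondecreasing \<Theta> a c x \<longleftrightarrow>
     mono_on {u\<in>{0..1}. right_endpoint \<Theta> a x u = ereal c} (\<lambda>u. c \<in> Theta_pt \<Theta> a x u)"

definition tie_nonincreasing ::
    "real set \<Rightarrow> (real \<Rightarrow> real \<Rightarrow> real) \<Rightarrow> real \<Rightarrow> real \<Rightarrow> bool" where
  "tie_nonincreasing \<Theta> a c x \<longleftrightarrow>
     antimono_on {u\<in>{0..1}. right_endpoint \<Theta> a x u = ereal c} (\<lambda>u. c \<in> Theta_pt \<Theta> a x u)"

end

theory Submission
  imports Defs
begin

text \<open>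
  Write \<open>G\<close> for the set of \<open>u\<close> with \<open>\<Theta>\<^sub>x(u) \<subseteq> A\<close>.  The belief in \<open>A\<close> is the probability of
  \<open>S \<subseteq> G\<close>, and the fiducial probability is \<open>P\<^sub>U(G)\<close>.  Every \<open>u \<notin> G\<close> is missed by \<open>S\<close>
  whenever \<open>S \<subseteq> G\<close>, so validity bounds the belief by \<open>P\<^sub>U(G)\<close>: the relative efficiency is at
  most \<open>1\<close>.  Monotonicity of the right endpoint makes \<open>G\<close> an initial (resp. final) segment of
  \<open>[0,1]\<close>, and then \<open>[0,U] \<subseteq> G\<close> (resp. \<open>[U,1] \<subseteq> G\<close>) is the event \<open>U \<in> G\<close>, so that the
  bound \<open>1\<close> is attained at every \<open>x\<close>.
\<close>

section \<open>The uniform space and measurable maps into the space of subsets of [0,1]\<close>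

lemma space_PU [simp]: "space PU = {0..1}"
  by (simp add: PU_def space_restrict_space)

lemma sets_PU: "sets PU = {K \<in> sets borel. K \<subseteq> {0..1}}"
  unfolding PU_def by (intro set_eqI) (simp add: sets_restrict_space_iff conj_commute)

lemma prob_space_PU: "prob_space PU"
  by (rule prob_spaceI) (simp add: PU_def space_restrict_space emeasure_restrict_space)

lemma measure_PU: "K \<in> sets PU \<Longrightarrow> measure PU K = measure lborel K"
  unfolding PU_def by (rule measure_restrict_space) (auto simp: sets_restrict_space_iff)

lemma space_subset_space [simp]: "space subset_space = Pow {0..1}"
  by (simp add: subset_space_def space_measure_of_conv)

lemma Pow_in_sets_subset_space:
  assumes "K \<in> sets PU"
  shows "Pow K \<in> sets subset_space"
proof -
  have "Pow ` sets PU \<subseteq> Pow (Pow {0..1})"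
    by (auto simp: sets_PU)
  then show ?thesis
    using assms by (auto simp: subset_space_def)
qed

text \<open>The sigma-algebra on subsets is generated by the events \<open>Pow K\<close>, so
  preimages need checking only there, and the preimage of \<open>Pow K\<close> is the set of
  \<open>u\<close> with \<open>f u\<close> inside \<open>K\<close>.\<close>

lemma measurable_subset_spaceI:
  assumes "\<And>u. u \<in> {0..1} \<Longrightarrow> f u \<subseteq> {0..1}"
    and "\<And>K. K \<in> sets PU \<Longrightarrow> {u \<in> {0..1}. f u \<subseteq> K} \<in> sets PU"
  shows "f \<in> PU \<rightarrow>\<^sub>M subset_space"
  unfolding subset_space_def
proof (rule measurable_measure_of)
  show "Pow ` sets PU \<subseteq> Pow (Pow {0..1})"
    by (auto simp: sets_PU)
  show "f \<in> space PU \<rightarrow> Pow {0..1}"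
    using assms(1) by auto
  fix B assume "B \<in> Pow ` sets PU"
  then obtain K where K: "K \<in> sets PU" "B = Pow K"
    by auto
  have "f -` B \<inter> space PU = {u \<in> {0..1}. f u \<subseteq> K}"
    using K by auto
  then show "f -` B \<inter> space PU \<in> sets PU"
    using assms(2) K by simp
qed

lemma measurable_singleton: "(\<lambda>u. {u}) \<in> PU \<rightarrow>\<^sub>M subset_space"
proof (rule measurable_subset_spaceI)
  fix K assume "K \<in> sets PU"
  moreover from this have "{u \<in> {0..1}. {u} \<subseteq> K} = K"
    by (auto simp: sets_PU)
  ultimately show "{u \<in> {0..1}. {u} \<subseteq> K} \<in> sets PU"
    by simp
qed auto

text \<open>A down-closed subset of [0,1] is an interval, hence Borel. Order alone thus gives
  measurability, both of the map sending \<open>u\<close> to [0,u] and, later, of the set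
  \<open>G\<close>, with no regularity of the association in \<open>u\<close>.\<close>

lemma initial_segment_in_sets_PU:
  assumes "K \<subseteq> {0..1}" and "\<And>u w. u \<in> K \<Longrightarrow> w \<in> {0..u} \<Longrightarrow> w \<in> K"
  shows "K \<in> sets PU"
proof -
  have "is_interval K"
    unfolding is_interval_1 using assms by (meson atLeastAtMost_iff order.trans subsetD)
  then show ?thesis
    using assms(1) by (simp add: sets_PU real_interval_borel_measurable)
qed

lemma final_segment_in_sets_PU:
  assumes "K \<subseteq> {0..1}" and "\<And>u w. u \<in> K \<Longrightarrow> w \<in> {u..1} \<Longrightarrow> w \<in> K"
  shows "K \<in> sets PU"
proof -
  have "is_interval K"
    unfolding is_interval_1 using assms by (meson atLeastAtMost_iff order.trans subsetD)
  then show ?thesis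
    using assms(1) by (simp add: sets_PU real_interval_borel_measurable)
qed

lemma measurable_initial_segment: "(\<lambda>u. {0..u}) \<in> PU \<rightarrow>\<^sub>M subset_space"
proof (rule measurable_subset_spaceI)
  show "{u \<in> {0..1}. {0..u} \<subseteq> K} \<in> sets PU" for K
    by (rule initial_segment_in_sets_PU) auto
qed auto

lemma measurable_final_segment: "(\<lambda>u. {u..1}) \<in> PU \<rightarrow>\<^sub>M subset_space"
proof (rule measurable_subset_spaceI)
  show "{u \<in> {0..1}. {u..1} \<subseteq> K} \<in> sets PU" for K
    by (rule final_segment_in_sets_PU) auto
qed auto

section \<open>Laws of random sets that are functions of a uniform variable\<close>

lemma space_set_law [simp]: "space (set_law f) = Pow {0..1}"
  by (simp add: set_law_def)

lemma sets_set_law [simp]: "sets (set_law f) = sets subset_space"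
  by (simp add: set_law_def)

lemma prob_space_set_law: "f \<in> PU \<rightarrow>\<^sub>M subset_space \<Longrightarrow> prob_space (set_law f)"
  unfolding set_law_def by (rule prob_space.prob_space_distr[OF prob_space_PU])

lemma measure_set_law_Pow:
  assumes f: "f \<in> PU \<rightarrow>\<^sub>M subset_space" and K: "K \<in> sets PU"
  shows "measure (set_law f) (Pow K) = measure PU {u \<in> {0..1}. f u \<subseteq> K}"
proof -
  have "measure (set_law f) (Pow K) = measure PU (f -` Pow K \<inter> space PU)"
    unfolding set_law_def by (intro measure_distr f Pow_in_sets_subset_space K)
  also have "f -` Pow K \<inter> space PU = {u \<in> {0..1}. f u \<subseteq> K}"
    by auto
  finally show ?thesis .
qed

lemma noncoverage_set_law:
  assumes f: "f \<in> PU \<rightarrow>\<^sub>M subset_space" and u: "u \<in> {0..1}"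
  shows "noncoverage (set_law f) u = measure PU {v \<in> {0..1}. u \<notin> f v}"
proof -
  have K: "{0..1} - {u} \<in> sets PU"
    by (auto simp: sets_PU)
  have "{s \<in> space (set_law f). u \<notin> s} = Pow ({0..1} - {u})"
    by auto
  then have "noncoverage (set_law f) u = measure PU {v \<in> {0..1}. f v \<subseteq> {0..1} - {u}}"
    using measure_set_law_Pow[OF f K] by (simp add: noncoverage_def)
  also have "{v \<in> {0..1}. f v \<subseteq> {0..1} - {u}} = {v \<in> {0..1}. u \<notin> f v}"
    using measurable_space[OF f] by auto
  finally show ?thesis .
qed

text \<open>The supporting chain is the range of \<open>f\<close>. It need not be an event, but any
  event containing it has the whole of [0,1] as preimage under \<open>f\<close>, hence probability
  one.\<close>

lemma nested_set_law:
  assumes f: "f \<in> PU \<rightarrow>\<^sub>M subset_space"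
    and sets: "\<And>u. u \<in> {0..1} \<Longrightarrow> f u \<in> sets PU"
    and chain: "\<And>u v. u \<in> {0..1} \<Longrightarrow> v \<in> {0..1} \<Longrightarrow> f u \<subseteq> f v \<or> f v \<subseteq> f u"
  shows "nested (set_law f)"
proof -
  interpret prob_space PU by (rule prob_space_PU)
  interpret L: prob_space "set_law f" by (rule prob_space_set_law[OF f])
  have sub: "f ` {0..1} \<subseteq> space (set_law f)"
    using measurable_space[OF f] unfolding space_PU space_subset_space space_set_law by blast
  have one: "emeasure (set_law f) B = 1" if B: "B \<in> sets (set_law f)" "f ` {0..1} \<subseteq> B" for B
  proof -
    have "emeasure (set_law f) B = emeasure PU (f -` B \<inter> space PU)"
      unfolding set_law_def using B f by (intro emeasure_distr) simp_all
    also have "f -` B \<inter> space PU = space PU"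
      using B by auto
    finally show ?thesis
      using emeasure_space_1 by simp
  qed
  have "outer_measure_of (set_law f) (f ` {0..1}) =
      (INF B \<in> {B \<in> sets (set_law f). f ` {0..1} \<subseteq> B}. 1)"
    unfolding outer_measure_of_def by (intro INF_cong refl) (use one in blast)
  \<comment> \<open>The whole space is an event containing the range, so the infimum is over a
    nonempty family; over the empty family it would be infinite.\<close>
  also have "\<dots> = 1"
    using sub sets.top[of "set_law f"] by (intro cINF_const) blast
  finally have "outer_measure_of (set_law f) (f ` {0..1}) = 1" .
  with sub show ?thesis
    unfolding nested_def by (intro exI[of _ "f ` {0..1}"]) (use sets chain in auto)
qed

section \<open>Validity of the two candidate sets, and the bound that validity puts on any random
  set\<close>

lemma nested_prs_initial_segment: "nested_prs (set_law (\<lambda>u. {0..u}))"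
proof -
  let ?S = "set_law (\<lambda>u. {0..u})"
  note f = measurable_initial_segment
  \<comment> \<open>[0,v] misses \<open>u\<close> exactly when v < u, an event of length
    \<open>u\<close>. So the noncoverage of a uniform variable is again uniform, and validity holds
    with equality at every \<alpha>.\<close>
  have Q: "noncoverage ?S u = u" if "u \<in> {0..1}" for u
  proof -
    have "{v \<in> {0..1}. u \<notin> {0..v}} = {0..<u}"
      using that by auto
    then show ?thesis
      using that by (simp add: noncoverage_set_law[OF f that] measure_PU sets_PU subset_eq)
  qed
  have "valid ?S"
    unfolding valid_def
  proof (intro conjI ballI)
    have "(\<lambda>u. u) \<in> borel_measurable PU"
      unfolding PU_def by (intro measurable_restrict_space1) simp
    then show "noncoverage ?S \<in> borel_measurable PU"
      by (subst measurable_cong[where g = "\<lambda>u. u"]) (simp_all add: Q)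
    fix \<alpha> :: real assume \<alpha>: "\<alpha> \<in> {0<..<1}"
    then have "{u \<in> space PU. noncoverage ?S u \<ge> 1 - \<alpha>} = {1 - \<alpha>..1}"
      using Q by auto
    with \<alpha> show "measure PU {u \<in> space PU. noncoverage ?S u \<ge> 1 - \<alpha>} \<le> \<alpha>"
      by (simp add: measure_PU sets_PU)
  qed
  moreover have "nested ?S"
    by (intro nested_set_law f) (auto simp: sets_PU)
  ultimately show ?thesis
    by (simp add: nested_prs_def random_subset_def prob_space_set_law[OF f])
qed

text \<open>Mirror image of the previous case under u -> 1 - u: [v,1] misses \<open>u\<close>
  exactly when v > u, so the noncoverage is 1 - u, again uniform.\<close>

lemma nested_prs_final_segment: "nested_prs (set_law (\<lambda>u. {u..1}))"
proof -
  let ?S = "set_law (\<lambda>u. {u..1})"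
  note f = measurable_final_segment
  have Q: "noncoverage ?S u = 1 - u" if "u \<in> {0..1}" for u
  proof -
    have "{v \<in> {0..1}. u \<notin> {v..1}} = {u<..1}"
      using that by auto
    then show ?thesis
      using that by (simp add: noncoverage_set_law[OF f that] measure_PU sets_PU subset_eq)
  qed
  have "valid ?S"
    unfolding valid_def
  proof (intro conjI ballI)
    have "(\<lambda>u. 1 - u) \<in> borel_measurable PU"
      unfolding PU_def by (intro measurable_restrict_space1) simp
    then show "noncoverage ?S \<in> borel_measurable PU"
      by (subst measurable_cong[where g = "\<lambda>u. 1 - u"]) (simp_all add: Q)
    fix \<alpha> :: real assume \<alpha>: "\<alpha> \<in> {0<..<1}"
    then have "{u \<in> space PU. noncoverage ?S u \<ge> 1 - \<alpha>} = {0..\<alpha>}"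
      using Q by auto
    with \<alpha> show "measure PU {u \<in> space PU. noncoverage ?S u \<ge> 1 - \<alpha>} \<le> \<alpha>"
      by (simp add: measure_PU sets_PU)
  qed
  moreover have "nested ?S"
    by (intro nested_set_law f) (auto simp: sets_PU)
  ultimately show ?thesis
    by (simp add: nested_prs_def random_subset_def prob_space_set_law[OF f])
qed

text \<open>With p the probability of \<open>Pow G\<close>, noncoverage is at least p off
  \<open>G\<close>, and validity at level 1 - p would give the claim directly. That level may be 0
  or 1, where validity says nothing, so p is approached by numbers q < p.\<close>

lemma valid_measure_Pow_le:
  assumes S: "random_subset S" "valid S" and G: "G \<in> sets PU"
  shows "measure S (Pow G) \<le> measure PU G"
proof (rule dense_le)
  fix q assume q: "q < measure S (Pow G)"
  interpret S: prob_space S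
    using S by (simp add: random_subset_def)
  interpret U: prob_space PU by (rule prob_space_PU)
  have sets_S: "sets S = sets subset_space"
    using S by (simp add: random_subset_def)
  then have space_S: "space S = Pow {0..1}"
    using sets_eq_imp_space_eq[of S subset_space] by simp
  show "q \<le> measure PU G"
  \<comment> \<open>For q \<le> 0 the level 1 - q is not below 1, but the bound is then trivial.
    Otherwise 0 < q < p \<le> 1 puts 1 - q strictly between 0 and 1.\<close>
  proof (cases "q \<le> 0")
    case True
    then show ?thesis
      using measure_nonneg[of PU G] by linarith
  next
    case False
    with order_less_le_trans[OF q S.prob_le_1] have q01: "1 - q \<in> {0<..<1}"
      by simp
    have Qq: "q \<le> noncoverage S u" if "u \<in> {0..1} - G" for u
    proof -
      have "{s \<in> space S. u \<notin> s} = Pow ({0..1} - {u})"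
        by (auto simp: space_S)
      moreover have "Pow ({0..1} - {u}) \<in> sets S"
        unfolding sets_S by (intro Pow_in_sets_subset_space) (auto simp: sets_PU)
      moreover have "Pow G \<subseteq> Pow ({0..1} - {u})"
        using that G by (auto simp: sets_PU)
      ultimately have "measure S (Pow G) \<le> noncoverage S u"
        by (simp add: noncoverage_def S.finite_measure_mono)
      with q show ?thesis
        by simp
    qed
    have "noncoverage S \<in> borel_measurable PU"
      using S by (simp add: valid_def)
    then have "{u \<in> space PU. noncoverage S u \<ge> 1 - (1 - q)} \<in> sets PU"
      by measurable
    moreover have "space PU - G \<subseteq> {u \<in> space PU. noncoverage S u \<ge> 1 - (1 - q)}"
      using Qq by auto
    \<comment> \<open>The complement of \<open>G\<close> lies where noncoverage is at least q,
      written 1 - (1 - q) to match validity at \<alpha> = 1 - q.\<close>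
    ultimately have "1 - measure PU G \<le> measure PU {u \<in> space PU. noncoverage S u \<ge> 1 - (1 - q)}"
      unfolding U.prob_compl[OF G, symmetric] by (rule U.finite_measure_mono[rotated])
    also have "\<dots> \<le> 1 - q"
      using S q01 unfolding valid_def by blast
    finally show ?thesis
      by simp
  qed
qed

section \<open>Belief as the probability of \<open>Pow G\<close>, a criterion for optimality, and
  comparison of endpoints\<close>

lemma bel_eq_measure_Pow:
  assumes "space S = Pow {0..1}"
  shows "bel \<Theta> a A S x = measure S (Pow {u \<in> {0..1}. Theta_pt \<Theta> a x u \<subseteq> A})"
proof -
  \<comment> \<open>A union lies in \<open>A\<close> iff each of its members does, so the belief
    event is one of the generating events as soon as \<open>G\<close> is Borel.\<close>
  have "{s \<in> space S. Theta_set \<Theta> a x s \<subseteq> A} = Pow {u \<in> {0..1}. Theta_pt \<Theta> a x u \<subseteq> A}"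
    using assms by (auto simp: Theta_set_def)
  then show ?thesis
    by (simp add: bel_def)
qed

text \<open>\<open>mem\<close> and \<open>closed\<close> say that \<open>f u\<close> lies in
  \<open>G\<close> exactly when \<open>u\<close> does, so belief and fiducial probability are both
  the uniform measure of \<open>G\<close>. The criterion refers to no order on [0,1] and therefore
  serves both directions of monotonicity.\<close>

lemma optimal_set_law:
  assumes f: "f \<in> PU \<rightarrow>\<^sub>M subset_space" and prs: "nested_prs (set_law f)"
    and mem: "\<And>u. u \<in> {0..1} \<Longrightarrow> u \<in> f u"
    and closed: "\<And>x u w. x \<in> \<X> \<Longrightarrow> u \<in> {0..1} \<Longrightarrow> w \<in> f u \<Longrightarrow>
      Theta_pt \<Theta> a x u \<subseteq> A \<Longrightarrow> Theta_pt \<Theta> a x w \<subseteq> A"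
    and sets: "\<And>x. x \<in> \<X> \<Longrightarrow> {u \<in> {0..1}. Theta_pt \<Theta> a x u \<subseteq> A} \<in> sets PU"
  shows "optimal \<X> \<Theta> P a A (set_law f)"
proof -
  have le: "rel_eff \<Theta> a A S' x \<le> rel_eff \<Theta> a A (set_law f) x"
    if S': "nested_prs S'" and x: "x \<in> \<X>" for S' x
  proof -
    define G where "G = {u \<in> {0..1}. Theta_pt \<Theta> a x u \<subseteq> A}"
    have G: "G \<in> sets PU"
      using sets[OF x] by (simp add: G_def)
    have "f u \<subseteq> G \<longleftrightarrow> u \<in> G" if "u \<in> {0..1}" for u
    proof
      show "u \<in> G" if "f u \<subseteq> G"
        using that mem[OF \<open>u \<in> {0..1}\<close>] by blast
      show "f u \<subseteq> G" if "u \<in> G"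
        using that closed[OF x \<open>u \<in> {0..1}\<close>] measurable_space[OF f, of u]
        unfolding G_def by auto
    qed
    then have "{u \<in> {0..1}. f u \<subseteq> G} = G" "{u \<in> {0..1}. {u} \<subseteq> G} = G"
      by (auto simp: G_def)
    then have "fid \<Theta> a A x = measure PU G" and "bel \<Theta> a A (set_law f) x = measure PU G"
      using measure_set_law_Pow[OF measurable_singleton G] measure_set_law_Pow[OF f G]
      by (simp_all add: fid_def bel_eq_measure_Pow G_def)
    moreover have "bel \<Theta> a A S' x \<le> measure PU G"
    proof -
      have "space S' = Pow {0..1}"
        using S' sets_eq_imp_space_eq[of S' subset_space]
        by (simp add: nested_prs_def random_subset_def)
      then show ?thesis
        using S' valid_measure_Pow_le[OF _ _ G]
        unfolding nested_prs_def G_def by (simp only: bel_eq_measure_Pow)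
    qed
    \<comment> \<open>Only a nonnegative denominator is needed: where the fiducial probability is
      zero, both quotients are 0 by the convention for division.\<close>
    ultimately show ?thesis
      unfolding rel_eff_def by (simp only: divide_right_mono measure_nonneg)
  qed
  \<comment> \<open>The inequality holds at every \<open>x\<close>, so superlevel sets are nested
    and the stochastic order follows under any law \<open>M\<close>, with no measurability in
    \<open>x\<close>.\<close>
  have "stoch_larger_on M {x \<in> \<X>. fid \<Theta> a A x \<noteq> 0} (rel_eff \<Theta> a A (set_law f)) (rel_eff \<Theta> a A S')"
    if "nested_prs S'" for S' M
    unfolding stoch_larger_on_def
    by (intro allI outer_measure_of_mono) (use le[OF that] in fastforce)
  with prs show ?thesis
    by (simp add: optimal_def more_efficient_def)
qed

text \<open>The endpoints give \<theta> \<le> c for every \<theta> in the set at \<open>w\<close>;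
  only \<theta> = c could break strictness. It would squeeze both endpoints to \<open>c\<close>, and
  the tie condition would then place \<open>c\<close> in the set at \<open>u\<close>, against
  \<open>sub\<close>.\<close>

lemma Theta_pt_subset_transfer:
  fixes c :: real
  assumes sub: "Theta_pt \<Theta> a x u \<subseteq> {\<theta> \<in> \<Theta>. \<theta> < c}"
    and le: "right_endpoint \<Theta> a x w \<le> right_endpoint \<Theta> a x u"
    and tie: "right_endpoint \<Theta> a x w = ereal c \<Longrightarrow> right_endpoint \<Theta> a x u = ereal c \<Longrightarrow>
      c \<in> Theta_pt \<Theta> a x w \<Longrightarrow> c \<in> Theta_pt \<Theta> a x u"
  shows "Theta_pt \<Theta> a x w \<subseteq> {\<theta> \<in> \<Theta>. \<theta> < c}"
proof
  fix \<theta> assume \<theta>: "\<theta> \<in> Theta_pt \<Theta> a x w"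
  have u: "right_endpoint \<Theta> a x u \<le> ereal c"
    unfolding right_endpoint_def using sub by (intro SUP_least) auto
  have w: "ereal \<theta> \<le> right_endpoint \<Theta> a x w"
    unfolding right_endpoint_def using \<theta> by (intro SUP_upper)
  have "\<theta> \<le> c"
    using order.trans[OF w order.trans[OF le u]] by simp
  moreover have "\<theta> \<noteq> c"
  proof
    assume "\<theta> = c"
    with w le u have "right_endpoint \<Theta> a x w = ereal c" "right_endpoint \<Theta> a x u = ereal c"
      by (auto intro: antisym order.trans)
    with tie \<theta> \<open>\<theta> = c\<close> sub show False
      by auto
  qed
  ultimately show "\<theta> \<in> {\<theta> \<in> \<Theta>. \<theta> < c}"
    using \<theta> by (auto simp: Theta_pt_def)
qed

section \<open>The two directions of monotonicity\<close>

theorem theorem4: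
  fixes \<X> \<Theta> A :: "real set" and P :: "real \<Rightarrow> real measure"
    and a :: "real \<Rightarrow> real \<Rightarrow> real" and \<theta>\<^sub>0 :: real
  assumes assoc: "association \<X> \<Theta> P a"
    and nonempty: "\<And>x u. x \<in> \<X> \<Longrightarrow> u \<in> {0..1} \<Longrightarrow> Theta_pt \<Theta> a x u \<noteq> {}"
    and A: "A = {\<theta>\<in>\<Theta>. \<theta> < \<theta>\<^sub>0}"
  shows "((\<forall>x\<in>\<X>. mono_on {0..1} (right_endpoint \<Theta> a x) \<and> tie_nondecreasing \<Theta> a \<theta>\<^sub>0 x) \<longrightarrow>
            optimal \<X> \<Theta> P a A (set_law (\<lambda>u. {0..u}))) \<and>
         ((\<forall>x\<in>\<X>. antimono_on {0..1} (right_endpoint \<Theta> a x) \<and> tie_nonincreasing \<Theta> a \<theta>\<^sub>0 x) \<longrightarrow>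
            optimal \<X> \<Theta> P a A (set_law (\<lambda>u. {u..1})))"
proof (intro conjI impI)
  assume mono: "\<forall>x\<in>\<X>. mono_on {0..1} (right_endpoint \<Theta> a x) \<and> tie_nondecreasing \<Theta> a \<theta>\<^sub>0 x"
  \<comment> \<open>Lowering \<open>u\<close> cannot raise the endpoint, so \<open>G\<close> is
    down-closed. This one fact supplies both the closure condition for [0,u] and the measurability
    of \<open>G\<close>.\<close>
  have closed: "Theta_pt \<Theta> a x w \<subseteq> A"
    if x: "x \<in> \<X>" and uw: "u \<in> {0..1}" "w \<in> {0..u}" and u: "Theta_pt \<Theta> a x u \<subseteq> A" for x u w
    unfolding A
  proof (rule Theta_pt_subset_transfer)
    show "Theta_pt \<Theta> a x u \<subseteq> {\<theta> \<in> \<Theta>. \<theta> < \<theta>\<^sub>0}"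
      using u A by simp
    show "right_endpoint \<Theta> a x w \<le> right_endpoint \<Theta> a x u"
      using mono x uw by (auto elim!: mono_onD)
    show "\<theta>\<^sub>0 \<in> Theta_pt \<Theta> a x u"
      if "right_endpoint \<Theta> a x w = ereal \<theta>\<^sub>0" "right_endpoint \<Theta> a x u = ereal \<theta>\<^sub>0"
        "\<theta>\<^sub>0 \<in> Theta_pt \<Theta> a x w"
      using mono x uw that unfolding tie_nondecreasing_def
      by (auto dest!: bspec[OF _ x] dest: mono_onD[where r = w and s = u])
  qed
  show "optimal \<X> \<Theta> P a A (set_law (\<lambda>u. {0..u}))"
  proof (rule optimal_set_law[OF measurable_initial_segment nested_prs_initial_segment])
    fix x assume "x \<in> \<X>"
    then show "{u \<in> {0..1}. Theta_pt \<Theta> a x u \<subseteq> A} \<in> sets PU"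
      using closed by (intro initial_segment_in_sets_PU) auto
  qed (use closed in auto)
next
  assume anti: "\<forall>x\<in>\<X>. antimono_on {0..1} (right_endpoint \<Theta> a x) \<and> tie_nonincreasing \<Theta> a \<theta>\<^sub>0 x"
  \<comment> \<open>Here raising \<open>u\<close> cannot raise the endpoint, so \<open>G\<close> is
    up-closed and [u,1] takes the place of [0,u].\<close>
  have closed: "Theta_pt \<Theta> a x w \<subseteq> A"
    if x: "x \<in> \<X>" and uw: "u \<in> {0..1}" "w \<in> {u..1}" and u: "Theta_pt \<Theta> a x u \<subseteq> A" for x u w
    unfolding A
  proof (rule Theta_pt_subset_transfer)
    show "Theta_pt \<Theta> a x u \<subseteq> {\<theta> \<in> \<Theta>. \<theta> < \<theta>\<^sub>0}"
      using u A by simp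
    show "right_endpoint \<Theta> a x w \<le> right_endpoint \<Theta> a x u"
      using anti x uw by (auto elim!: monotone_onD)
    show "\<theta>\<^sub>0 \<in> Theta_pt \<Theta> a x u"
      if "right_endpoint \<Theta> a x w = ereal \<theta>\<^sub>0" "right_endpoint \<Theta> a x u = ereal \<theta>\<^sub>0"
        "\<theta>\<^sub>0 \<in> Theta_pt \<Theta> a x w"
      using anti x uw that unfolding tie_nonincreasing_def
      by (auto dest!: bspec[OF _ x] dest: monotone_onD[where x = u and y = w])
  qed
  show "optimal \<X> \<Theta> P a A (set_law (\<lambda>u. {u..1}))"
  proof (rule optimal_set_law[OF measurable_final_segment nested_prs_final_segment])
    fix x assume "x \<in> \<X>"
    then show "{u \<in> {0..1}. Theta_pt \<Theta> a x u \<subseteq> A} \<in> sets PU"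
      using closed by (intro final_segment_in_sets_PU) auto
  qed (use closed in auto)
qed

end
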